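(* Let $(X,\mathscr{B},\mu,T)$ be a strongly mixing measure preserving system and let $f \in L^1(X,\mu)$ satisfy $\int_X f\,d\mu = 0$. Then for $\mu$-a.e. $x \in X$, the sequence $\left(f(T^n x)\right)_{n=1}^{\infty}$ is a strongly mixing sequence.
   Context: A measure preserving system (m.p.s.) $(X,\mathscr{B},\mu,T)$ consists of a set $X$, a $\sigma$-algebra $\mathscr{B}$ of subsets of $X$, a probability measure $\mu$ on $(X,\mathscr{B})$ and a measurable transformation $T:X\to X$ with $\mu(A)=\mu(T^{-1}A)$ for all $A\in\mathscr{B}$. Functions are complex-valued and $\mathbb{N}=\{1,2,3,\dots\}$. The m.p.s. $(X,\mathscr{B},\mu,T)$ is strongly mixing if for every $A,B\in\mathscr{B}$, $\lim_{n\to\infty}\mu(A\cap T^{-n}B)=\mu(A)\mu(B)$. Strongly mixing sequence: let $(x_n)_{n=1}^\infty\subseteq\mathbb{C}$ satisfy $\limsup_{N\to\infty}\frac1N\sum_{n=1}^N|x_n|<\infty$. Then $(x_n)_{n=1}^\infty$ is a strongly mixing sequence if the following holds: whenever $(y_n)_{n=1}^\infty\subseteq\mathbb{C}$ is a bounded sequence and $(N_q)_{q=1}^\infty\subseteq\mathbb{N}$ is a strictly increasing sequence such that $\ell(h):=\lim_{q\to\infty}\frac{1}{N_q}\sum_{n=1}^{N_q}x_{n+h}\overline{y_n}$ exists for every $h\in\mathbb{N}$, we have $\lim_{h\to\infty}|\ell(h)|=0$. *)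

theory Defs
  imports "HOL-Probability.Probability"
begin

locale measure_preserving_system = prob_space M
  for M :: "'a measure" and T :: "'a \<Rightarrow> 'a" +
  assumes measurable_T: "T \<in> measurable M M"
    and measure_preserving:
      "\<And>A. A \<in> sets M \<Longrightarrow> measure M (T -` A \<inter> space M) = measure M A"

locale strongly_mixing_system = measure_preserving_system M T
  for M :: "'a measure" and T :: "'a \<Rightarrow> 'a" +
  assumes strongly_mixing:
    "\<And>A B. A \<in> sets M \<Longrightarrow> B \<in> sets M \<Longrightarrow>
      (\<lambda>n. measure M (A \<inter> ((T ^^ n) -` B \<inter> space M)))
        \<longlonglongrightarrow> measure M A * measure M B"

text \<open>
  Sequences are indexed by the positive integers; the entries \<open>x 0\<close>, \<open>y 0\<close> and \<open>l 0\<close> are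
  never constrained. The subsequence \<open>Q\<close> takes positive values; its own index starts at 0,
  which only relabels it. The bound on the averages of \<open>norm (x n)\<close> is part of the notion.
\<close>

definition strongly_mixing_sequence :: "(nat \<Rightarrow> complex) \<Rightarrow> bool" where
  "strongly_mixing_sequence x \<longleftrightarrow>
     limsup (\<lambda>N. ereal ((1 / real N) * (\<Sum>n=1..N. norm (x n)))) < \<infinity> \<and>
     (\<forall>(y :: nat \<Rightarrow> complex) (Q :: nat \<Rightarrow> nat) (l :: nat \<Rightarrow> complex).
        bounded (y ` {1..}) \<longrightarrow>
        strict_mono Q \<longrightarrow>
        (\<forall>q. Q q \<ge> 1) \<longrightarrow>
        (\<forall>h\<ge>1. (\<lambda>q. (1 / of_nat (Q q)) * (\<Sum>n=1..Q q. x (n + h) * cnj (y n))) \<longlonglongrightarrow> l h) \<longrightarrow>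
        (\<lambda>h. norm (l h)) \<longlonglongrightarrow> 0)"

end

theory Submission
  imports Defs
begin

text \<open>
  Two ingredients meet: the pointwise ergodic theorem, and the near orthogonality of shifts that
  are far apart.

  Suppose first that \<open>f\<close> is bounded. By the ergodic theorem, almost every orbit
  \<open>x n = f (T\<^sup>n x)\<close> has Cesaro correlations: the averages of \<open>x (n + i) * cnj (x (n + j))\<close>
  converge to the integral of \<open>f \<circ> T\<^sup>i\<close> against \<open>f \<circ> T\<^sup>j\<close>, which by mixing and
  \<open>\<integral>f = 0\<close> is small once \<open>\<bar>i - j\<bar>\<close> is large. If \<open>\<bar>l h\<bar> \<ge> d\<close> held for infinitely many \<open>h\<close>,
  one could pick \<open>K\<close> of them, \<open>s 0 < s 1 < \<dots>\<close>, with large gaps, and unimodular numbers \<open>c k\<close> with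
  \<open>c k * l (s k) = \<bar>l (s k)\<bar>\<close>. Summing, the averages of
  \<open>(\<Sum>k<K. c k * x (n + s k)) * cnj (y n)\<close> tend to something of size at least \<open>K * d\<close>. But the
  inner sum has mean square about \<open>K\<close>, because its terms are nearly orthogonal, so that these
  averages are of order \<open>\<surd>K\<close>; this is absurd for large \<open>K\<close>.

  For \<open>f\<close> merely integrable its correlations need not exist. Instead \<open>f\<close> is approximated in
  \<open>L\<^sup>1\<close> by simple functions \<open>g\<close> of mean zero, and the ergodic theorem applied to \<open>\<bar>f - g\<bar>\<close> makes
  the orbits of \<open>f\<close> and \<open>g\<close> close on average, by the same margin for every shift. The argument above only
  involves upper bounds for averages, so it tolerates this error: the limits that exist for \<open>f\<close>
  need not exist for \<open>g\<close>. This is the content of \<open>strongly_mixing_sequenceI\<close>, which has no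
  dynamics in it; \<open>sparse_combinations_small\<close> is its mean square estimate. Only countably many
  functions and shifts occur, so the exceptional sets combine to a null set that does not
  depend on \<open>y\<close> or on the subsequence.
\<close>

section \<open>Measure preserving maps\<close>

context measure_preserving_system
begin

lemma measurable_funpow [measurable]: "T ^^ n \<in> measurable M M"
proof (induction n)
  case (Suc n)
  then show ?case
    using measurable_T by (simp add: measurable_comp)
qed simp

lemma distr_T: "distr M M T = M"
proof (rule measure_eqI)
  fix A assume "A \<in> sets (distr M M T)"
  then show "emeasure (distr M M T) A = emeasure M A"
    using measurable_T measure_preserving[of A] by (simp add: emeasure_distr emeasure_eq_measure)
qed simp

lemma distr_funpow: "distr M M (T ^^ n) = M"
proof (induction n)
  case 0
  have "distr M M (T ^^ 0) = distr M M (\<lambda>x. x)"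
    by (rule distr_cong) auto
  then show ?case by simp
next
  case (Suc n)
  have "distr M M (T ^^ Suc n) = distr (distr M M (T ^^ n)) M T"
    unfolding funpow.simps using measurable_T by (intro distr_distr[symmetric] measurable_funpow)
  then show ?case
    unfolding Suc distr_T .
qed

lemma integrable_funpow:
  fixes f :: "'a \<Rightarrow> 'b :: {banach, second_countable_topology}"
  assumes "integrable M f"
  shows "integrable M (\<lambda>x. f ((T ^^ n) x))"
  using assms integrable_distr[OF measurable_funpow, of n f] by (simp add: distr_funpow)

lemma integral_funpow:
  fixes f :: "'a \<Rightarrow> 'b :: {banach, second_countable_topology}"
  assumes "f \<in> borel_measurable M"
  shows "(\<integral>x. f ((T ^^ n) x) \<partial>M) = integral\<^sup>L M f"
  using integral_distr[OF measurable_funpow assms, of n] by (simp add: distr_funpow)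

lemmas integrable_T = integrable_funpow[of _ 1, simplified]
lemmas integral_T = integral_funpow[of _ 1, simplified]

end

section \<open>The pointwise ergodic theorem\<close>

locale ergodic_system = measure_preserving_system M T
  for M :: "'a measure" and T :: "'a \<Rightarrow> 'a" +
  assumes ergodic: "\<And>A. A \<in> sets M \<Longrightarrow> T -` A \<inter> space M = A \<Longrightarrow> prob A = 0 \<or> prob A = 1"

text \<open>
  An invariant set \<open>A\<close> is its own preimage under every iterate, so mixing of \<open>A\<close> with itself
  reads \<open>prob A = prob A * prob A\<close>.
\<close>

sublocale strongly_mixing_system \<subseteq> ergodic_system
proof
  fix A assume A: "A \<in> sets M" and inv: "T -` A \<inter> space M = A"
  have "(T ^^ n) -` A \<inter> space M = A" for n
  proof (induction n)
    case 0
    then show ?case using sets.sets_into_space[OF A] by auto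
  next
    case (Suc n)
    have "x \<in> (T ^^ Suc n) -` A \<inter> space M \<longleftrightarrow> x \<in> (T ^^ n) -` A \<inter> space M" for x
      using inv measurable_space[OF measurable_funpow[of n], of x] by auto
    then show ?case using Suc by blast
  qed
  then have "(\<lambda>n. prob A) \<longlonglongrightarrow> prob A * prob A"
    using strongly_mixing[OF A A] by simp
  then have "prob A = prob A * prob A"
    using LIMSEQ_unique tendsto_const by blast
  then show "prob A = 0 \<or> prob A = 1"
    by simp
qed

text \<open>
  \<open>running_max T f n x\<close> is the largest of the orbit sums of \<open>f\<close> at \<open>x\<close> of lengths \<open>1\<close> to
  \<open>n + 1\<close>. The recursion through \<open>T x\<close> is what the proof of the ergodic theorem exploits.
\<close>

primrec running_max :: "('a \<Rightarrow> 'a) \<Rightarrow> ('a \<Rightarrow> real) \<Rightarrow> nat \<Rightarrow> 'a \<Rightarrow> real" where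
  "running_max T f 0 x = f x"
| "running_max T f (Suc n) x = f x + max 0 (running_max T f n (T x))"

lemma running_max_mono_Suc: "running_max T f n x \<le> running_max T f (Suc n) x"
proof (induction n arbitrary: x)
  case (Suc n)
  then show ?case
    using Suc[of "T x"] unfolding running_max.simps by (intro add_left_mono max.mono order_refl)
qed simp

lemma running_max_mono: "m \<le> n \<Longrightarrow> running_max T f m x \<le> running_max T f n x"
  by (rule lift_Suc_mono_le[of "\<lambda>n. running_max T f n x"]) (simp_all only: running_max_mono_Suc)

lemma orbit_sum_le_running_max: "(\<Sum>k\<le>n. f ((T ^^ k) x)) \<le> running_max T f n x"
proof (induction n arbitrary: x)
  case (Suc n)
  have "(\<Sum>k\<le>Suc n. f ((T ^^ k) x)) = f x + (\<Sum>k\<le>n. f ((T ^^ k) (T x)))"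
    by (subst sum.atMost_Suc_shift) (simp add: funpow_swap1)
  also have "\<dots> \<le> running_max T f (Suc n) x"
    using Suc[of "T x"] by simp
  finally show ?case .
qed simp

context measure_preserving_system
begin

lemma integrable_running_max:
  assumes "integrable M f"
  shows "integrable M (running_max T f n)"
proof (induction n)
  case 0
  then show ?case using assms by (simp add: fun_eq_iff[symmetric])
next
  case (Suc n)
  have "integrable M (\<lambda>x. f x + max 0 (running_max T f n (T x)))"
    using assms integrable_T[OF Suc] by (intro Bochner_Integration.integrable_add integrable_max) auto
  then show ?case by simp
qed

end

text \<open>
  Let \<open>A\<close> be the set where the running maxima \<open>F n\<close> are unbounded; the recursion makes it
  invariant. On \<open>A\<close> the difference \<open>F (n + 1) - F n \<circ> T = f - min 0 (F n \<circ> T)\<close> tends to \<open>f\<close>,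
  while its integral over \<open>A\<close> is that of \<open>F (n + 1) - F n\<close>, hence nonnegative. So \<open>f\<close> has
  nonnegative integral over \<open>A\<close>, which rules out \<open>prob A = 1\<close>; by ergodicity \<open>A\<close> is null.
\<close>

lemma (in ergodic_system) orbit_sums_bounded_above:
  fixes f :: "'a \<Rightarrow> real"
  assumes f: "integrable M f" and neg: "integral\<^sup>L M f < 0"
  shows "AE x in M. \<exists>c. \<forall>n. (\<Sum>k\<le>n. f ((T ^^ k) x)) \<le> c"
proof -
  define F where "F = running_max T f"
  define A where "A = {x \<in> space M. \<forall>c::nat. \<exists>n. real c < F n x}"
  have intF: "integrable M (F n)" for n
    unfolding F_def by (rule integrable_running_max[OF f])
  note [measurable] = measurable_T
  have [measurable]: "F n \<in> borel_measurable M" for n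
    using intF by auto
  have [measurable]: "f \<in> borel_measurable M"
    using f by auto
  have A [measurable]: "A \<in> sets M"
    unfolding A_def by measurable
  have inA: "(\<exists>n. c < F n x)" if xA: "x \<in> A" for x c
  proof -
    obtain k :: nat where "c < real k" using reals_Archimedean2 by blast
    moreover obtain n where "real k < F n x" using xA unfolding A_def by blast
    ultimately show ?thesis by (meson less_trans)
  qed
  have F_Suc: "F (Suc n) x = f x + max 0 (F n (T x))" for n x
    by (simp add: F_def)
  have F_mono: "m \<le> n \<Longrightarrow> F m x \<le> F n x" for m n x
    by (simp add: F_def running_max_mono)
  have Tsp: "T x \<in> space M" if "x \<in> space M" for x
    using that measurable_T by (rule measurable_space[rotated])
  have inv_iff: "T x \<in> A \<longleftrightarrow> x \<in> A" if x: "x \<in> space M" for x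
  proof
    assume TA: "T x \<in> A"
    have "\<exists>n. real c < F n x" for c :: nat
    proof -
      obtain n where "real c - f x < F n (T x)"
        using inA[OF TA] by blast
      then have "real c < F (Suc n) x"
        by (simp add: F_Suc)
      then show ?thesis ..
    qed
    then show "x \<in> A" using x by (simp add: A_def)
  next
    assume xA: "x \<in> A"
    have "\<exists>n. real c < F n (T x)" for c :: nat
    proof -
      obtain n where "real c + f x < F n x" using inA[OF xA] by blast
      also have "F n x \<le> F (Suc n) x" by (rule F_mono) simp
      finally have "real c < max 0 (F n (T x))" by (simp add: F_Suc)
      then have "real c < F n (T x)" by (simp add: max_def split: if_splits)
      then show ?thesis ..
    qed
    then show "T x \<in> A" using x Tsp by (simp add: A_def)
  qed
  have inv: "T -` A \<inter> space M = A"
    using inv_iff A_def by auto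
  define G where "G n x = indicat_real A x * (f x - min 0 (F n (T x)))" for n x
  have G_eq: "G n x = indicat_real A x * F (Suc n) x - indicat_real A x * F n (T x)" for n x
    by (simp add: G_def F_Suc algebra_simps max_def min_def)
  have G_nonneg: "0 \<le> integral\<^sup>L M (G n)" for n
  proof -
    have i1: "integrable M (\<lambda>x. indicat_real A x * F k x)" for k
      using integrable_mult_indicator[OF A intF, of k] by simp
    have i2: "integrable M (\<lambda>x. indicat_real A x * F n (T x))"
      using integrable_mult_indicator[OF A integrable_T[OF intF], of n] by simp
    have "(\<integral>x. indicat_real A x * F n (T x) \<partial>M) = (\<integral>x. indicat_real A (T x) * F n (T x) \<partial>M)"
      by (intro Bochner_Integration.integral_cong) (auto simp: indicator_def inv_iff)
    also have "\<dots> = (\<integral>x. indicat_real A x * F n x \<partial>M)"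
      by (rule integral_T[of "\<lambda>x. indicat_real A x * F n x"]) measurable
    also have "\<dots> \<le> (\<integral>x. indicat_real A x * F (Suc n) x \<partial>M)"
      by (intro integral_mono i1) (auto simp: indicator_def intro: F_mono)
    finally show ?thesis
      unfolding G_eq using i1 i2 by simp
  qed
  \<comment> \<open>Since \<open>F 0 = f\<close> and \<open>F\<close> increases, \<open>min 0 (F n \<circ> T)\<close> is at most \<open>\<bar>f \<circ> T\<bar>\<close> in absolute
    value: this gives the dominating function.\<close>
  have "(\<lambda>n. integral\<^sup>L M (G n)) \<longlonglongrightarrow> (\<integral>x. indicat_real A x * f x \<partial>M)"
  proof (rule integral_dominated_convergence[where w = "\<lambda>x. \<bar>f x\<bar> + \<bar>f (T x)\<bar>"])
    show "integrable M (\<lambda>x. \<bar>f x\<bar> + \<bar>f (T x)\<bar>)"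
      using f integrable_T[OF f] by auto
    show "AE x in M. (\<lambda>n. G n x) \<longlonglongrightarrow> indicat_real A x * f x"
    proof (rule AE_I2)
      fix x assume x: "x \<in> space M"
      show "(\<lambda>n. G n x) \<longlonglongrightarrow> indicat_real A x * f x"
      proof (cases "x \<in> A")
        case True
        then obtain n0 where n0: "0 < F n0 (T x)"
          using inv_iff[OF x] inA by blast
        have "eventually (\<lambda>n. G n x = indicat_real A x * f x) sequentially"
          using eventually_ge_at_top[of n0]
        proof eventually_elim
          case (elim n)
          then show ?case
            using n0 F_mono[of n0 n "T x"] by (simp add: G_def min_def)
        qed
        then show ?thesis by (rule tendsto_eventually)
      qed (simp add: G_def)
    qed
    show "AE x in M. norm (G n x) \<le> \<bar>f x\<bar> + \<bar>f (T x)\<bar>" for n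
    proof (rule AE_I2)
      fix x
      have "f (T x) \<le> F n (T x)"
        using F_mono[of 0 n "T x"] by (simp add: F_def)
      then show "norm (G n x) \<le> \<bar>f x\<bar> + \<bar>f (T x)\<bar>"
        by (auto simp: G_def indicator_def min_def)
    qed
  next
    show "G n \<in> borel_measurable M" for n
      unfolding G_def by measurable
  qed simp
  then have int_A: "0 \<le> (\<integral>x. indicat_real A x * f x \<partial>M)"
    using G_nonneg by (intro LIMSEQ_le_const) auto
  have "prob A \<noteq> 1"
  proof
    assume "prob A = 1"
    then have "AE x in M. x \<in> A" by (simp add: prob_eq_1)
    then have "(\<integral>x. indicat_real A x * f x \<partial>M) = integral\<^sup>L M f"
      by (intro integral_cong_AE) auto
    then show False using int_A neg by simp
  qed
  then have "prob A = 0" using ergodic[OF A inv] by blast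
  then have "AE x in M. x \<notin> A"
    using A by (simp add: prob_eq_0)
  then show ?thesis
  proof (rule AE_mp, intro AE_I2 impI)
    fix x assume "x \<in> space M" "x \<notin> A"
    then obtain c :: nat where c: "\<And>n. F n x \<le> real c"
      by (auto simp: A_def not_less)
    have "(\<Sum>k\<le>n. f ((T ^^ k) x)) \<le> real c" for n
      using orbit_sum_le_running_max[of f T x n] c[of n] by (simp add: F_def)
    then show "\<exists>c. \<forall>n. (\<Sum>k\<le>n. f ((T ^^ k) x)) \<le> c" by blast
  qed
qed

text \<open>
  For \<open>a\<close> strictly between \<open>\<integral>f\<close> and \<open>b\<close>, the orbit sums of \<open>f \<circ> T - a\<close> are bounded by a
  constant, which becomes negligible after division by \<open>N\<close>. The composition with \<open>T\<close> makes the
  averages start at \<open>n = 1\<close>.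
\<close>

lemma (in ergodic_system) orbit_averages_eventually_less:
  fixes f :: "'a \<Rightarrow> real"
  assumes f: "integrable M f" and less: "integral\<^sup>L M f < b"
  shows "AE x in M. eventually (\<lambda>N. (1 / real N) * (\<Sum>n=1..N. f ((T ^^ n) x)) < b) sequentially"
proof -
  define a where "a = (integral\<^sup>L M f + b) / 2"
  have a: "integral\<^sup>L M f < a" "a < b" using less by (simp_all add: a_def)
  have "AE x in M. \<exists>c. \<forall>n. (\<Sum>k\<le>n. f (T ((T ^^ k) x)) - a) \<le> c"
  proof (rule orbit_sums_bounded_above)
    show "integrable M (\<lambda>x. f (T x) - a)"
      using integrable_T[OF f] by simp
    show "(\<integral>x. f (T x) - a \<partial>M) < 0"
      using integrable_T[OF f] integral_T[of f] f a by (simp add: prob_space)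
  qed
  then show ?thesis
  proof (rule AE_mp, intro AE_I2 impI)
    fix x assume "\<exists>c. \<forall>n. (\<Sum>k\<le>n. f (T ((T ^^ k) x)) - a) \<le> c"
    then obtain c where c: "\<And>n. (\<Sum>k\<le>n. f (T ((T ^^ k) x)) - a) \<le> c" by blast
    have sum_le: "(\<Sum>n=1..N. f ((T ^^ n) x)) \<le> c + real N * a" if N: "1 \<le> N" for N
    proof -
      obtain m where m: "N = Suc m" using N by (cases N) auto
      have "(\<Sum>n=1..N. f ((T ^^ n) x)) = (\<Sum>k\<le>m. f ((T ^^ Suc k) x))"
        unfolding m by (rule sum.reindex_bij_witness[of _ Suc "\<lambda>n. n - 1"]) auto
      then show ?thesis
        using c[of m] by (simp add: m sum_subtractf)
    qed
    have "((\<lambda>N. c / real N + a) \<longlongrightarrow> 0 + a) sequentially"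
      by (intro tendsto_intros lim_const_over_n)
    then have "eventually (\<lambda>N. c / real N + a < b) sequentially"
      using a by (intro order_tendstoD(2)) auto
    then show "eventually (\<lambda>N. (1 / real N) * (\<Sum>n=1..N. f ((T ^^ n) x)) < b) sequentially"
      using eventually_ge_at_top[of 1]
    proof eventually_elim
      case (elim N)
      have "(1 / real N) * (\<Sum>n=1..N. f ((T ^^ n) x)) \<le> (1 / real N) * (c + real N * a)"
        using sum_le[of N] elim by (intro mult_left_mono) auto
      also have "\<dots> = c / real N + a"
        using elim by (simp add: field_simps)
      finally show ?case using elim by simp
    qed
  qed
qed

theorem (in ergodic_system) pointwise_ergodic_real:
  fixes f :: "'a \<Rightarrow> real"
  assumes f: "integrable M f"
  shows "AE x in M. (\<lambda>N. (1 / real N) * (\<Sum>n=1..N. f ((T ^^ n) x))) \<longlonglongrightarrow> integral\<^sup>L M f"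
proof -
  let ?avg = "\<lambda>N x. (1 / real N) * (\<Sum>n=1..N. f ((T ^^ n) x))"
  define e where "e j = inverse (real (Suc j))" for j
  have e: "0 < e j" for j by (simp add: e_def)
  have "AE x in M. \<forall>j. eventually (\<lambda>N. ?avg N x < integral\<^sup>L M f + e j) sequentially"
    unfolding AE_all_countable using orbit_averages_eventually_less[OF f] e by simp
  moreover have "AE x in M. \<forall>j. eventually (\<lambda>N. - ?avg N x < - integral\<^sup>L M f + e j) sequentially"
    unfolding AE_all_countable
    using orbit_averages_eventually_less[of "\<lambda>x. - f x" "- integral\<^sup>L M f + e _"] f e
    by (simp add: sum_negf)
  ultimately show ?thesis
  proof eventually_elim
    case (elim x)
    show ?case
    proof (rule tendstoI)
      fix r :: real assume "0 < r"
      then obtain j where j: "e j < r"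
        unfolding e_def using reals_Archimedean by blast
      show "eventually (\<lambda>N. dist (?avg N x) (integral\<^sup>L M f) < r) sequentially"
        using elim(1)[rule_format, of j] elim(2)[rule_format, of j]
        by eventually_elim (use j in \<open>auto simp: dist_real_def\<close>)
    qed
  qed
qed

theorem (in ergodic_system) pointwise_ergodic_complex:
  fixes f :: "'a \<Rightarrow> complex"
  assumes f: "integrable M f"
  shows "AE x in M. (\<lambda>N. (1 / of_nat N) * (\<Sum>n=1..N. f ((T ^^ n) x))) \<longlonglongrightarrow> integral\<^sup>L M f"
proof -
  have "integrable M (\<lambda>x. Re (f x))" "integrable M (\<lambda>x. Im (f x))"
    using f by auto
  from this[THEN pointwise_ergodic_real] show ?thesis
  proof eventually_elim
    case (elim x)
    have "complex_of_real (1 / real N) * (\<Sum>n=1..N. f ((T ^^ n) x))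
        = Complex ((1 / real N) * (\<Sum>n=1..N. Re (f ((T ^^ n) x))))
                  ((1 / real N) * (\<Sum>n=1..N. Im (f ((T ^^ n) x))))" for N
      by (simp add: complex_eq_iff)
    then show ?case
      using tendsto_Complex[OF elim] f by (simp add: integral_Re integral_Im)
  qed
qed


section \<open>Decaying correlations along sparse shifts\<close>

text \<open>
  Both indices of \<open>\<Gamma>\<close> are shifted, rather than one, so that no statement about shifting a Cesaro
  average is needed. The bound on the diagonal is the bounded mean square of the shifts of \<open>g\<close>.
\<close>

definition decaying_correlations :: "(nat \<Rightarrow> complex) \<Rightarrow> bool" where
  "decaying_correlations g \<longleftrightarrow> (\<exists>\<Gamma> C.
     (\<forall>i j. (\<lambda>N. (1 / of_nat N) * (\<Sum>n=1..N. g (n + i) * cnj (g (n + j)))) \<longlonglongrightarrow> \<Gamma> i j) \<and>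
     (\<forall>i. norm (\<Gamma> i i) \<le> C) \<and>
     (\<forall>e>0. \<exists>m. \<forall>i j. i + m \<le> j \<longrightarrow> norm (\<Gamma> i j) \<le> e))"

text \<open>
  Shifts \<open>s k\<close> from \<open>H\<close> with all gaps at least \<open>m\<close> are nearly orthogonal, so a combination of
  \<open>K\<close> of them with coefficients in the unit disc has mean square at most \<open>K * C + K\<^sup>2 * \<eta>\<close>: the
  diagonal and the off-diagonal part. This is below \<open>(K * th)\<^sup>2\<close> for small \<open>\<eta>\<close> and large \<open>K\<close>,
  and the mean absolute value is controlled by the mean square. Since the shifts are chosen before
  the coefficients, the latter may depend on the former.
\<close>

lemma sparse_combinations_small:
  assumes g: "decaying_correlations g" and H: "infinite H" and th: "0 < th"
  obtains K :: nat and s :: "nat \<Rightarrow> nat" where "0 < K" "\<forall>k. s k \<in> H"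
    "\<forall>c. (\<forall>k. norm (c k) \<le> 1) \<longrightarrow>
      eventually (\<lambda>N. (1 / real N) * (\<Sum>n=1..N. norm (\<Sum>k<K. c k * g (n + s k))) < real K * th) sequentially"
proof -
  from g obtain \<Gamma> C where
    lim': "\<forall>i j. (\<lambda>N. (1 / of_nat N) * (\<Sum>n=1..N. g (n + i) * cnj (g (n + j)))) \<longlonglongrightarrow> \<Gamma> i j"
    and C': "\<forall>i. norm (\<Gamma> i i) \<le> C"
    and decay: "\<forall>e>0. \<exists>m. \<forall>i j. i + m \<le> j \<longrightarrow> norm (\<Gamma> i j) \<le> e"
    unfolding decaying_correlations_def by (elim exE conjE) (rule that)
  note lim = lim'[THEN spec, THEN spec] and C = C'[THEN spec]
  define \<eta> where "\<eta> = th\<^sup>2 / 4"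
  have \<eta>: "0 < \<eta>" using th by (simp add: \<eta>_def)
  obtain m where m: "\<And>i j. i + m \<le> j \<Longrightarrow> norm (\<Gamma> i j) \<le> \<eta>"
    using decay \<eta> by blast
  have sym: "\<Gamma> j i = cnj (\<Gamma> i j)" for i j
  proof (rule LIMSEQ_unique[OF lim])
    show "(\<lambda>N. (1 / of_nat N) * (\<Sum>n=1..N. g (n + j) * cnj (g (n + i)))) \<longlonglongrightarrow> cnj (\<Gamma> i j)"
      using tendsto_cnj[OF lim[of i j]] by (simp add: mult.commute)
  qed
  obtain K0 :: nat where K0: "C / \<eta> < real K0" using reals_Archimedean2 by blast
  define K where "K = Suc K0"
  have K: "0 < K" "C \<le> real K * \<eta>"
    using K0 \<eta> by (auto simp: K_def field_simps)
  \<comment> \<open>Every \<open>m\<close>-th element of \<open>H\<close>: consecutive ones are at least \<open>m\<close> apart.\<close>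
  define s where "s k = enumerate H (m * k)" for k
  have gap: "s i + m \<le> s j" if "i < j" for i j
  proof -
    have "p + d \<le> q \<Longrightarrow> enumerate H p + d \<le> enumerate H q" for p q d
    proof (induction d arbitrary: q)
      case 0
      then show ?case using H by (simp add: enumerate_mono_le_iff)
    next
      case (Suc d)
      then obtain q' where q': "q = Suc q'" by (cases q) auto
      have "enumerate H p + d \<le> enumerate H q'" using Suc q' by simp
      also have "\<dots> < enumerate H q" using H q' by (simp add: enumerate_step)
      finally show ?case by simp
    qed
    moreover have "m * i + m \<le> m * j"
      using that mult_le_mono2[of "Suc i" j m] by simp
    ultimately show ?thesis by (simp add: s_def)
  qed
  have \<Gamma>s: "norm (\<Gamma> (s i) (s j)) \<le> (if i = j then C else 0) + \<eta>" for i j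
  proof (cases i j rule: linorder_cases)
    case less
    then show ?thesis using m[OF gap[OF less]] by simp
  next
    case equal
    then show ?thesis using C[of "s i"] \<eta> by simp
  next
    case greater
    then show ?thesis using m[OF gap[OF greater]] sym[of "s i" "s j"] by simp
  qed
  show ?thesis
  proof (rule that[of K s])
    show "0 < K" by (rule K)
    show "\<forall>k. s k \<in> H" using H by (simp add: s_def enumerate_in_set)
    show "\<forall>c. (\<forall>k. norm (c k) \<le> 1) \<longrightarrow>
      eventually (\<lambda>N. (1 / real N) * (\<Sum>n=1..N. norm (\<Sum>k<K. c k * g (n + s k))) < real K * th) sequentially"
    proof (intro allI impI)
      fix c :: "nat \<Rightarrow> complex" assume c1: "\<forall>k. norm (c k) \<le> 1"
      then have c: "norm (c k) \<le> 1" for k by blast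
      define G where "G n = (\<Sum>k<K. c k * g (n + s k))" for n
      define L where "L = (\<Sum>i<K. \<Sum>j<K. c i * cnj (c j) * \<Gamma> (s i) (s j))"
      have "(\<lambda>N. \<Sum>i<K. \<Sum>j<K. c i * cnj (c j) *
          ((1 / of_nat N) * (\<Sum>n=1..N. g (n + s i) * cnj (g (n + s j))))) \<longlonglongrightarrow> L"
        unfolding L_def by (intro tendsto_sum tendsto_mult lim tendsto_const)
      moreover have "(\<Sum>i<K. \<Sum>j<K. c i * cnj (c j) *
          ((1 / of_nat N) * (\<Sum>n=1..N. g (n + s i) * cnj (g (n + s j)))))
        = of_real ((1 / real N) * (\<Sum>n=1..N. (norm (G n))\<^sup>2))" for N
      proof -
        have "of_real ((norm (G n))\<^sup>2)
            = (\<Sum>i<K. \<Sum>j<K. c i * cnj (c j) * (g (n + s i) * cnj (g (n + s j))))" for n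
          unfolding complex_norm_square
          by (simp add: G_def cnj_sum sum_product mult_ac)
        then have "of_real ((1 / real N) * (\<Sum>n=1..N. (norm (G n))\<^sup>2))
            = (1 / of_nat N) * (\<Sum>n=1..N. \<Sum>i<K. \<Sum>j<K. c i * cnj (c j) * (g (n + s i) * cnj (g (n + s j))))"
          by simp
        also have "(\<Sum>n=1..N. \<Sum>i<K. \<Sum>j<K. c i * cnj (c j) * (g (n + s i) * cnj (g (n + s j))))
            = (\<Sum>i<K. \<Sum>j<K. \<Sum>n=1..N. c i * cnj (c j) * (g (n + s i) * cnj (g (n + s j))))"
          by (subst sum.swap, rule sum.cong[OF refl], rule sum.swap)
        finally show ?thesis
          by (simp add: sum_distrib_left sum_divide_distrib mult_ac)
      qed
      ultimately have "(\<lambda>N. of_real ((1 / real N) * (\<Sum>n=1..N. (norm (G n))\<^sup>2))) \<longlonglongrightarrow> L"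
        by simp
      then have lim_sq: "(\<lambda>N. (1 / real N) * (\<Sum>n=1..N. (norm (G n))\<^sup>2)) \<longlonglongrightarrow> Re L"
        using tendsto_Re by fastforce
      have "norm L \<le> (\<Sum>i<K. \<Sum>j<K. (if i = j then C else 0) + \<eta>)"
        unfolding L_def
      proof (intro sum_norm_le)
        fix i j
        have "norm (c i * cnj (c j) * \<Gamma> (s i) (s j)) \<le> 1 * 1 * ((if i = j then C else 0) + \<eta>)"
          unfolding norm_mult complex_mod_cnj by (intro mult_mono c \<Gamma>s) auto
        then show "norm (c i * cnj (c j) * \<Gamma> (s i) (s j)) \<le> (if i = j then C else 0) + \<eta>"
          by simp
      qed
      also have "\<dots> = real K * C + (real K)\<^sup>2 * \<eta>"
        by (simp add: sum.distrib power2_eq_square algebra_simps)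
      also have "\<dots> \<le> real K * (real K * \<eta>) + (real K)\<^sup>2 * \<eta>"
        using K by (intro add_mono mult_left_mono) auto
      also have "\<dots> < (real K * th)\<^sup>2"
        using K th by (simp add: \<eta>_def power2_eq_square)
      finally have "Re L < (real K * th)\<^sup>2"
        using complex_Re_le_cmod[of L] by linarith
      then have "eventually (\<lambda>N. (1 / real N) * (\<Sum>n=1..N. (norm (G n))\<^sup>2) < (real K * th)\<^sup>2) sequentially"
        using lim_sq by (rule order_tendstoD(2)[rotated])
      then show "eventually (\<lambda>N. (1 / real N) * (\<Sum>n=1..N. norm (\<Sum>k<K. c k * g (n + s k))) < real K * th) sequentially"
        using eventually_ge_at_top[of 1]
      proof eventually_elim
        case (elim N)
        define a where "a = real K * th"
        have a: "0 < a" using K th by (simp add: a_def)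
        \<comment> \<open>The inequality \<open>2 a t \<le> t\<^sup>2 + a\<^sup>2\<close> with \<open>a = K * th\<close>, the size to be reached, serves in
          place of Cauchy--Schwarz.\<close>
        have "2 * a * norm (G n) \<le> (norm (G n))\<^sup>2 + a\<^sup>2" for n
          using sum_squares_bound[of "norm (G n)" a] by (simp add: mult_ac)
        then have "(\<Sum>n=1..N. 2 * a * norm (G n)) \<le> (\<Sum>n=1..N. (norm (G n))\<^sup>2 + a\<^sup>2)"
          by (intro sum_mono) auto
        then have "2 * a * (\<Sum>n=1..N. norm (G n)) \<le> (\<Sum>n=1..N. (norm (G n))\<^sup>2) + real N * a\<^sup>2"
          by (simp add: sum_distrib_left sum.distrib)
        also have "\<dots> < 2 * a * (real N * a)"
          using elim unfolding a_def[symmetric] by (simp add: field_simps power2_eq_square)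
        finally have "(\<Sum>n=1..N. norm (G n)) < real N * a"
          using a by simp
        then show ?case
          using elim by (simp add: G_def a_def field_simps)
      qed
    qed
  qed
qed

text \<open>
  If \<open>\<bar>l h\<bar> \<ge> d\<close> infinitely often, take sparse shifts \<open>s k\<close> among these \<open>h\<close> and align the phases
  of \<open>l (s k)\<close>. The combination of limits is at least \<open>K * d\<close>. On the other hand it is bounded by
  the bound \<open>B\<close> for \<open>y\<close> times the average of \<open>\<bar>\<Sum>k<K. c k * x (n + s k)\<bar>\<close>, in which replacing
  \<open>x\<close> by \<open>g\<close> costs \<open>K * e\<close> and the rest is below \<open>K * e\<close> as well.
\<close>

lemma strongly_mixing_sequenceI:
  assumes bdd: "limsup (\<lambda>N. ereal ((1 / real N) * (\<Sum>n=1..N. norm (x n)))) < \<infinity>"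
    and approx: "\<And>e. 0 < e \<Longrightarrow> \<exists>g. decaying_correlations g \<and>
      (\<forall>h. eventually (\<lambda>N. (1 / real N) * (\<Sum>n=1..N. norm (x (n + h) - g (n + h))) < e) sequentially)"
  shows "strongly_mixing_sequence x"
  unfolding strongly_mixing_sequence_def
proof (intro conjI allI impI)
  fix y :: "nat \<Rightarrow> complex" and Q :: "nat \<Rightarrow> nat" and l :: "nat \<Rightarrow> complex"
  assume y: "bounded (y ` {1..})" and Q: "strict_mono Q" and Q1: "\<forall>q. 1 \<le> Q q"
    and lim: "\<forall>h\<ge>1. (\<lambda>q. (1 / of_nat (Q q)) * (\<Sum>n=1..Q q. x (n + h) * cnj (y n))) \<longlonglongrightarrow> l h"
  obtain B where B: "0 < B" "\<And>n. 1 \<le> n \<Longrightarrow> norm (y n) \<le> B"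
    using y unfolding bounded_pos by auto
  show "(\<lambda>h. norm (l h)) \<longlonglongrightarrow> 0"
  proof (rule ccontr)
    assume "\<not> (\<lambda>h. norm (l h)) \<longlonglongrightarrow> 0"
    then obtain d where d: "0 < d" and "\<not> eventually (\<lambda>h. norm (l h) < d) sequentially"
      by (auto simp: tendsto_iff)
    then have "\<forall>k. \<exists>h\<ge>k. d \<le> norm (l h)"
      by (auto simp: eventually_sequentially not_less)
    then have inf: "infinite {h. 1 \<le> h \<and> d \<le> norm (l h)}"
      unfolding infinite_nat_iff_unbounded_le
      by (metis (mono_tags, lifting) max.bounded_iff mem_Collect_eq)
    \<comment> \<open>With this choice the two errors, \<open>B * K * e\<close> each, add up to half of \<open>K * d\<close>.\<close>
    define e where "e = d / (4 * B)"
    have e: "0 < e" using d B by (simp add: e_def)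
    obtain g where g: "decaying_correlations g"
      and close: "\<And>h. eventually (\<lambda>N. (1 / real N) * (\<Sum>n=1..N. norm (x (n + h) - g (n + h))) < e) sequentially"
      using approx[OF e] by blast
    obtain K :: nat and s where K: "0 < K" and s: "\<forall>k. s k \<in> {h. 1 \<le> h \<and> d \<le> norm (l h)}"
      and small: "\<forall>c. (\<forall>k. norm (c k) \<le> 1) \<longrightarrow>
        eventually (\<lambda>N. (1 / real N) * (\<Sum>n=1..N. norm (\<Sum>k<K. c k * g (n + s k))) < real K * e) sequentially"
      by (rule sparse_combinations_small[OF g inf e])
    define c where "c k = cnj (sgn (l (s k)))" for k
    have c: "norm (c k) \<le> 1" for k by (simp add: c_def norm_sgn)
    have c_l: "c k * l (s k) = of_real (norm (l (s k)))" for k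
    proof -
      have "cnj z * z = of_real (norm z) * of_real (norm z)" for z
        by (metis complex_norm_square mult.commute power2_eq_square of_real_power)
      then show ?thesis
        by (simp add: c_def sgn_eq)
    qed
    define D where "D N = (\<Sum>k<K. c k * ((1 / of_nat N) * (\<Sum>n=1..N. x (n + s k) * cnj (y n))))" for N
    have "(\<lambda>q. D (Q q)) \<longlonglongrightarrow> (\<Sum>k<K. c k * l (s k))"
      unfolding D_def using lim s by (intro tendsto_sum tendsto_mult tendsto_const) auto
    then have "(\<lambda>q. D (Q q)) \<longlonglongrightarrow> of_real (\<Sum>k<K. norm (l (s k)))"
      by (simp add: c_l)
    from tendsto_norm[OF this]
    have limD: "(\<lambda>q. norm (D (Q q))) \<longlonglongrightarrow> (\<Sum>k<K. norm (l (s k)))"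
      by (simp only: norm_of_real abs_of_nonneg sum_nonneg norm_ge_zero)
    have "eventually (\<lambda>N. \<forall>k\<in>{..<K}. (1 / real N) * (\<Sum>n=1..N. norm (x (n + s k) - g (n + s k))) < e) sequentially"
      by (rule eventually_ball_finite) (use close in auto)
    then have "eventually (\<lambda>N. norm (D N) \<le> real K * d / 2) sequentially"
      using small[rule_format, of c, OF c] eventually_ge_at_top[of 1]
    proof eventually_elim
      case (elim N)
      let ?r = "\<lambda>k n. norm (x (n + s k) - g (n + s k))"
      let ?G = "\<lambda>n. norm (\<Sum>k<K. c k * g (n + s k))"
      have "D N = (1 / of_nat N) * (\<Sum>k<K. \<Sum>n=1..N. c k * x (n + s k) * cnj (y n))"
        by (simp add: D_def sum_distrib_left sum_divide_distrib mult_ac)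
      also have "\<dots> = (1 / of_nat N) * (\<Sum>n=1..N. (\<Sum>k<K. c k * x (n + s k)) * cnj (y n))"
        by (subst sum.swap) (simp add: sum_distrib_right)
      finally have "norm (D N) = (1 / real N) * norm (\<Sum>n=1..N. (\<Sum>k<K. c k * x (n + s k)) * cnj (y n))"
        by (simp add: norm_mult norm_divide)
      also have "\<dots> \<le> (1 / real N) * (\<Sum>n=1..N. ((\<Sum>k<K. ?r k n) + ?G n) * B)"
      proof (intro mult_left_mono sum_norm_le)
        fix n assume "n \<in> {1..N}"
        have "norm (\<Sum>k<K. c k * x (n + s k))
            = norm ((\<Sum>k<K. c k * (x (n + s k) - g (n + s k))) + (\<Sum>k<K. c k * g (n + s k)))"
          by (simp add: sum.distrib[symmetric] algebra_simps)
        also have "\<dots> \<le> norm (\<Sum>k<K. c k * (x (n + s k) - g (n + s k))) + ?G n"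
          by (rule norm_triangle_ineq)
        also have "norm (\<Sum>k<K. c k * (x (n + s k) - g (n + s k))) \<le> (\<Sum>k<K. ?r k n)"
        proof (rule sum_norm_le)
          fix k
          have "norm (c k * (x (n + s k) - g (n + s k))) \<le> 1 * ?r k n"
            unfolding norm_mult by (intro mult_right_mono c) auto
          then show "norm (c k * (x (n + s k) - g (n + s k))) \<le> ?r k n" by simp
        qed
        finally have "norm (\<Sum>k<K. c k * x (n + s k)) \<le> (\<Sum>k<K. ?r k n) + ?G n" by simp
        then show "norm ((\<Sum>k<K. c k * x (n + s k)) * cnj (y n)) \<le> ((\<Sum>k<K. ?r k n) + ?G n) * B"
          unfolding norm_mult complex_mod_cnj
          using B(2)[of n] \<open>n \<in> {1..N}\<close> by (intro mult_mono) (auto intro!: add_nonneg_nonneg sum_nonneg)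
      qed auto
      also have "\<dots> = B * ((\<Sum>k<K. (1 / real N) * (\<Sum>n=1..N. ?r k n)) + (1 / real N) * (\<Sum>n=1..N. ?G n))"
      proof -
        have "(\<Sum>n=1..N. ((\<Sum>k<K. ?r k n) + ?G n) * B)
            = B * ((\<Sum>k<K. \<Sum>n=1..N. ?r k n) + (\<Sum>n=1..N. ?G n))"
          unfolding sum.swap[of "\<lambda>k n. ?r k n"] sum.distrib[symmetric] sum_distrib_left
          by (simp only: mult.commute)
        then show ?thesis
          by (simp add: sum_divide_distrib[symmetric] distrib_left add_divide_distrib)
      qed
      also have "\<dots> \<le> B * ((\<Sum>k<K. e) + real K * e)"
        using elim B(1) by (intro mult_left_mono add_mono sum_mono) (auto intro: less_imp_le)
      also have "\<dots> = real K * d / 2"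
        using B(1) by (simp add: e_def field_simps)
      finally show ?case .
    qed
    then have "eventually (\<lambda>q. norm (D (Q q)) \<le> real K * d / 2) sequentially"
      using filterlim_subseq[OF Q] by (rule eventually_compose_filterlim)
    then have "(\<Sum>k<K. norm (l (s k))) \<le> real K * d / 2"
      using limD by (intro tendsto_upperbound[OF limD]) auto
    moreover have "real K * d \<le> (\<Sum>k<K. norm (l (s k)))"
      using sum_mono[of "{..<K}" "\<lambda>_. d" "\<lambda>k. norm (l (s k))"] s by auto
    moreover have "0 < real K * d"
      using K d by simp
    ultimately show False
      by linarith
  qed
qed (rule bdd)

section \<open>Orbits of a strongly mixing system\<close>

text \<open>
  Expanding both factors over the level sets of \<open>g\<close> reduces the claim to mixing of finitely many
  pairs of sets.
\<close>

lemma (in strongly_mixing_system) simple_function_mixing: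
  fixes g :: "'a \<Rightarrow> complex"
  assumes g: "simple_function M g"
  shows "(\<lambda>h. \<integral>x. g x * cnj (g ((T ^^ h) x)) \<partial>M) \<longlonglongrightarrow> integral\<^sup>L M g * cnj (integral\<^sup>L M g)"
proof -
  define V where "V = g ` space M"
  define A where "A v = g -` {v} \<inter> space M" for v
  have fin: "finite V" using g by (simp add: V_def simple_function_def)
  have A [measurable]: "A v \<in> sets M" for v
    using simple_functionD(2)[OF g] by (simp add: A_def)
  have TA [measurable]: "(T ^^ h) -` A v \<inter> space M \<in> sets M" for h v
    by (rule measurable_sets[OF measurable_funpow A])
  have rep: "g x = (\<Sum>v\<in>V. v * indicator (A v) x)" if "x \<in> space M" for x
  proof -
    have "indicator S x *\<^sub>R v = v * indicator S x" for S and v :: complex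
      by (simp add: indicator_def)
    then show ?thesis
      using simple_function_indicator_representation_banach[OF g that]
      by (simp only: V_def A_def)
  qed
  have int_ind: "integrable M (\<lambda>x. indicator S x :: complex)"
      "(\<integral>x. indicator S x \<partial>M) = complex_of_real (prob S)" if "S \<in> events" for S
  proof -
    have eq: "(\<lambda>x. indicator S x :: complex) = (\<lambda>x. of_real (indicat_real S x))"
      by (simp add: of_real_indicator)
    have "integrable M (indicat_real S)"
      using that by (simp add: integrable_indicator_iff emeasure_eq_measure)
    then show "integrable M (\<lambda>x. indicator S x :: complex)"
      unfolding eq by (rule integrable_of_real)
    show "(\<integral>x. indicator S x \<partial>M) = complex_of_real (prob S)"
      unfolding eq integral_complex_of_real using that by simp
  qed
  have int_g: "integral\<^sup>L M g = (\<Sum>v\<in>V. v * of_real (prob (A v)))"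
  proof -
    have "integral\<^sup>L M g = (\<integral>x. (\<Sum>v\<in>V. v * indicator (A v) x) \<partial>M)"
      by (intro Bochner_Integration.integral_cong) (auto simp: rep)
    then show ?thesis
      by (simp add: Bochner_Integration.integral_sum int_ind)
  qed
  have corr: "(\<integral>x. g x * cnj (g ((T ^^ h) x)) \<partial>M)
      = (\<Sum>v\<in>V. \<Sum>w\<in>V. v * cnj w * of_real (prob (A v \<inter> ((T ^^ h) -` A w \<inter> space M))))" for h
  proof -
    have "(\<integral>x. g x * cnj (g ((T ^^ h) x)) \<partial>M)
        = (\<integral>x. (\<Sum>v\<in>V. \<Sum>w\<in>V. v * cnj w * indicator (A v \<inter> ((T ^^ h) -` A w \<inter> space M)) x) \<partial>M)"
    proof (intro Bochner_Integration.integral_cong refl)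
      fix x assume x: "x \<in> space M"
      then have Tx: "(T ^^ h) x \<in> space M" by (rule measurable_space[OF measurable_funpow])
      have ind: "indicator (A v) x * indicator (A w) ((T ^^ h) x)
          = (indicator (A v \<inter> ((T ^^ h) -` A w \<inter> space M)) x :: complex)" for v w
        using x by (auto simp: indicator_def)
      have cnj_ind: "cnj (indicator S z) = indicator S z" for S and z :: 'a
        by (simp add: indicator_def)
      show "g x * cnj (g ((T ^^ h) x))
          = (\<Sum>v\<in>V. \<Sum>w\<in>V. v * cnj w * indicator (A v \<inter> ((T ^^ h) -` A w \<inter> space M)) x)"
        unfolding rep[OF x] rep[OF Tx] cnj_sum sum_product complex_cnj_mult cnj_ind ind[symmetric]
        by (simp only: mult_ac)
    qed
    then show ?thesis
      by (simp add: Bochner_Integration.integral_sum int_ind)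
  qed
  have "(\<lambda>h. \<Sum>v\<in>V. \<Sum>w\<in>V. v * cnj w * of_real (prob (A v \<inter> ((T ^^ h) -` A w \<inter> space M))))
      \<longlonglongrightarrow> (\<Sum>v\<in>V. \<Sum>w\<in>V. v * cnj w * of_real (prob (A v) * prob (A w)))"
    by (intro tendsto_sum tendsto_mult tendsto_const tendsto_of_real strongly_mixing A)
  also have "(\<Sum>v\<in>V. \<Sum>w\<in>V. v * cnj w * of_real (prob (A v) * prob (A w)))
      = integral\<^sup>L M g * cnj (integral\<^sup>L M g)"
    unfolding int_g cnj_sum sum_product by (simp add: mult_ac)
  finally show ?thesis
    unfolding corr .
qed

text \<open>
  The ergodic theorem for the bounded function \<open>(g \<circ> T\<^sup>i) * cnj (g \<circ> T\<^sup>j)\<close> identifies the limit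
  \<open>\<Gamma> i j\<close> as its integral, which depends only on \<open>j - i\<close> by invariance of the measure and decays
  by mixing.
\<close>

lemma (in strongly_mixing_system) orbit_decaying_correlations:
  fixes g :: "'a \<Rightarrow> complex"
  assumes g: "simple_function M g" and mean0: "integral\<^sup>L M g = 0"
  shows "AE x in M. decaying_correlations (\<lambda>n. g ((T ^^ n) x))"
proof -
  define \<Gamma> where "\<Gamma> i j = (\<integral>x. g ((T ^^ i) x) * cnj (g ((T ^^ j) x)) \<partial>M)" for i j
  have [measurable]: "g \<in> borel_measurable M"
    using g by (rule borel_measurable_simple_function)
  have [measurable]: "cnj \<in> borel_measurable borel"
    by (intro borel_measurable_continuous_onI continuous_intros)
  have [measurable]: "(\<lambda>x. g ((T ^^ k) x)) \<in> borel_measurable M" for k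
    by (rule measurable_compose[OF measurable_funpow]) measurable
  have shift: "\<Gamma> i (i + k) = \<Gamma> 0 k" for i k
  proof -
    have "\<Gamma> i (i + k) = (\<integral>x. (\<lambda>z. g z * cnj (g ((T ^^ k) z))) ((T ^^ i) x) \<partial>M)"
      by (simp add: \<Gamma>_def funpow_add add.commute[of i k])
    also have "\<dots> = \<Gamma> 0 k"
      unfolding \<Gamma>_def by (subst integral_funpow) auto
    finally show ?thesis .
  qed
  have decay: "\<exists>m. \<forall>i j. i + m \<le> j \<longrightarrow> norm (\<Gamma> i j) \<le> e" if "0 < e" for e
  proof -
    have "(\<lambda>k. \<Gamma> 0 k) \<longlonglongrightarrow> 0"
      using simple_function_mixing[OF g] by (simp add: \<Gamma>_def mean0)
    then obtain m where m: "\<And>k. m \<le> k \<Longrightarrow> norm (\<Gamma> 0 k) < e"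
      using LIMSEQ_D[of "\<Gamma> 0" 0 e] \<open>0 < e\<close> by auto
    have "norm (\<Gamma> i j) \<le> e" if "i + m \<le> j" for i j
    proof -
      have "m \<le> j - i" using that by simp
      then show ?thesis
        using m[of "j - i"] shift[of i "j - i"] that by simp
    qed
    then show ?thesis by blast
  qed
  have "AE x in M. \<forall>i j. (\<lambda>N. (1 / of_nat N) * (\<Sum>n=1..N. g ((T ^^ (n + i)) x) * cnj (g ((T ^^ (n + j)) x))))
      \<longlonglongrightarrow> \<Gamma> i j"
    unfolding AE_all_countable
  proof (intro allI)
    fix i j
    have sf: "finite (g ` space M)" using g by (simp add: simple_function_def)
    then obtain b where b: "\<And>x. x \<in> space M \<Longrightarrow> norm (g x) \<le> b"
      using finite_imp_bounded[OF sf] unfolding bounded_iff by auto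
    have sp: "(T ^^ k) x \<in> space M" if "x \<in> space M" for k x
      using that by (rule measurable_space[OF measurable_funpow])
    have "integrable M (\<lambda>x. g ((T ^^ i) x) * cnj (g ((T ^^ j) x)))"
    proof (rule integrable_const_bound[where B = "b * b"])
      show "AE x in M. norm (g ((T ^^ i) x) * cnj (g ((T ^^ j) x))) \<le> b * b"
      proof (rule AE_I2)
        fix x assume "x \<in> space M"
        then show "norm (g ((T ^^ i) x) * cnj (g ((T ^^ j) x))) \<le> b * b"
          unfolding norm_mult complex_mod_cnj
          by (intro mult_mono b sp) (auto intro: order_trans[OF norm_ge_zero b])
      qed
    qed measurable
    from pointwise_ergodic_complex[OF this]
    show "AE x in M. (\<lambda>N. (1 / of_nat N) * (\<Sum>n=1..N. g ((T ^^ (n + i)) x) * cnj (g ((T ^^ (n + j)) x))))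
        \<longlonglongrightarrow> \<Gamma> i j"
      by (simp add: \<Gamma>_def funpow_add add.commute[of _ i] add.commute[of _ j])
  qed
  then show ?thesis
  proof eventually_elim
    case (elim x)
    have "norm (\<Gamma> i i) \<le> norm (\<Gamma> 0 0)" for i
      using shift[of i 0] by simp
    then show ?case
      unfolding decaying_correlations_def using elim decay by blast
  qed
qed

text \<open>
  Subtracting its mean from a simple function close to \<open>f\<close> keeps it simple and at most doubles the
  error, since that mean is close to \<open>\<integral>f = 0\<close>.
\<close>

lemma (in prob_space) mean_zero_simple_approximation:
  fixes f :: "'a \<Rightarrow> complex"
  assumes f: "integrable M f" and f0: "integral\<^sup>L M f = 0" and e: "0 < e"
  obtains g where "simple_function M g" "integral\<^sup>L M g = 0" "integrable M g"
    "(\<integral>x. norm (f x - g x) \<partial>M) < e"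
proof -
  obtain z where "has_bochner_integral M f z"
    using f by (auto simp: integrable.simps)
  then obtain s where s: "\<And>i. Bochner_Integration.simple_bochner_integrable M (s i)"
    and lim: "(\<lambda>i. \<integral>\<^sup>+x. norm (f x - s i x) \<partial>M) \<longlonglongrightarrow> 0"
  proof cases
    case (1 s)
    then show thesis by (intro that[of s])
  qed
  have "eventually (\<lambda>i. (\<integral>\<^sup>+x. norm (f x - s i x) \<partial>M) < ennreal (e / 2)) sequentially"
    using lim e by (intro order_tendstoD(2)) auto
  then obtain i where i: "(\<integral>\<^sup>+x. norm (f x - s i x) \<partial>M) < ennreal (e / 2)"
    by (auto simp: eventually_sequentially)
  have si: "integrable M (s i)" by (rule integrableI_simple_bochner_integrable[OF s])
  have sf: "simple_function M (s i)" using s[of i] by (auto elim: Bochner_Integration.simple_bochner_integrable.cases)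
  have int: "integrable M (\<lambda>x. f x - s i x)" using f si by simp
  have less: "(\<integral>x. norm (f x - s i x) \<partial>M) < e / 2"
    using i e int by (simp add: nn_integral_eq_integral ennreal_less_iff)
  define a where "a = integral\<^sup>L M (s i)"
  have "a = - (\<integral>x. f x - s i x \<partial>M)" using f si f0 by (simp add: a_def)
  then have "norm a \<le> (\<integral>x. norm (f x - s i x) \<partial>M)"
    by (metis integral_norm_bound norm_minus_cancel)
  then have a: "norm a < e / 2" using less by simp
  show ?thesis
  proof (rule that[of "\<lambda>x. s i x - a"])
    show "simple_function M (\<lambda>x. s i x - a)"
      using simple_function_compose1[OF sf, of "\<lambda>z. z - a"] by simp
    show "integral\<^sup>L M (\<lambda>x. s i x - a) = 0"
      using si by (simp add: a_def prob_space)
    show "integrable M (\<lambda>x. s i x - a)" using si by simp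
    have "(\<integral>x. norm (f x - (s i x - a)) \<partial>M) \<le> (\<integral>x. norm (f x - s i x) + norm a \<partial>M)"
    proof (rule integral_mono)
      show "integrable M (\<lambda>x. norm (f x - (s i x - a)))" using f si by simp
      show "integrable M (\<lambda>x. norm (f x - s i x) + norm a)" using int by simp
      show "norm (f x - (s i x - a)) \<le> norm (f x - s i x) + norm a" for x
        using norm_triangle_ineq[of "f x - s i x" a] by (simp add: algebra_simps)
    qed
    also have "\<dots> = (\<integral>x. norm (f x - s i x) \<partial>M) + norm a"
      using int by (simp add: prob_space)
    finally show "(\<integral>x. norm (f x - (s i x - a)) \<partial>M) < e"
      using less a by simp
  qed
qed

theorem theorem1p10:
  fixes M :: "'a measure" and T :: "'a \<Rightarrow> 'a" and f :: "'a \<Rightarrow> complex"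
  assumes "strongly_mixing_system M T"
    and "integrable M f"
    and "integral\<^sup>L M f = 0"
  shows "AE x in M. strongly_mixing_sequence (\<lambda>n. f ((T ^^ n) x))"
proof -
  interpret strongly_mixing_system M T by fact
  define e where "e j = inverse (real (Suc j))" for j
  have "\<exists>g. \<forall>j. simple_function M (g j) \<and> integral\<^sup>L M (g j) = 0 \<and> integrable M (g j) \<and>
      (\<integral>x. norm (f x - g j x) \<partial>M) < e j"
    using mean_zero_simple_approximation[OF assms(2,3), of "e _"]
    by (intro choice allI) (metis e_def inverse_positive_iff_positive of_nat_0_less_iff zero_less_Suc)
  then obtain g where sf: "\<And>j. simple_function M (g j)" and mean0: "\<And>j. integral\<^sup>L M (g j) = 0"
    and int_g: "\<And>j. integrable M (g j)" and close: "\<And>j. (\<integral>x. norm (f x - g j x) \<partial>M) < e j"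
    by blast
  have "AE x in M. \<forall>j. decaying_correlations (\<lambda>n. g j ((T ^^ n) x))"
    unfolding AE_all_countable using orbit_decaying_correlations[OF sf mean0] by simp
  moreover have "AE x in M. \<forall>j h. eventually (\<lambda>N. (1 / real N) *
      (\<Sum>n=1..N. norm (f ((T ^^ (n + h)) x) - g j ((T ^^ (n + h)) x))) < e j) sequentially"
    unfolding AE_all_countable
  proof (intro allI)
    fix j h
    have int: "integrable M (\<lambda>x. norm (f x - g j x))"
      using assms(2) int_g[of j] by simp
    have "(\<integral>x. norm (f ((T ^^ h) x) - g j ((T ^^ h) x)) \<partial>M) < e j"
      using integral_funpow[of "\<lambda>x. norm (f x - g j x)" h] int close[of j] by auto
    from orbit_averages_eventually_less[OF integrable_funpow[OF int, of h] this]
    show "AE x in M. eventually (\<lambda>N. (1 / real N) *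
        (\<Sum>n=1..N. norm (f ((T ^^ (n + h)) x) - g j ((T ^^ (n + h)) x))) < e j) sequentially"
      by (simp add: funpow_add add.commute[of _ h])
  qed
  moreover have "AE x in M. (\<lambda>N. (1 / real N) * (\<Sum>n=1..N. norm (f ((T ^^ n) x))))
      \<longlonglongrightarrow> (\<integral>x. norm (f x) \<partial>M)"
    using assms(2) by (intro pointwise_ergodic_real) simp
  ultimately show ?thesis
  proof eventually_elim
    case (elim x)
    show ?case
    proof (rule strongly_mixing_sequenceI)
      have "(\<lambda>N. ereal ((1 / real N) * (\<Sum>n=1..N. norm (f ((T ^^ n) x)))))
          \<longlonglongrightarrow> ereal (\<integral>x. norm (f x) \<partial>M)"
        using elim(3) by (simp only: lim_ereal)
      then have "limsup (\<lambda>N. ereal ((1 / real N) * (\<Sum>n=1..N. norm (f ((T ^^ n) x)))))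
          = ereal (\<integral>x. norm (f x) \<partial>M)"
        by (rule lim_imp_Limsup[OF sequentially_bot])
      then show "limsup (\<lambda>N. ereal ((1 / real N) * (\<Sum>n=1..N. norm (f ((T ^^ n) x))))) < \<infinity>"
        by simp
      fix r :: real assume "0 < r"
      then obtain j where j: "e j < r"
        unfolding e_def using reals_Archimedean by blast
      have "eventually (\<lambda>N. (1 / real N) *
          (\<Sum>n=1..N. norm (f ((T ^^ (n + h)) x) - g j ((T ^^ (n + h)) x))) < r) sequentially" for h
        using elim(2)[rule_format, of h j] by eventually_elim (use j in linarith)
      then show "\<exists>g. decaying_correlations g \<and> (\<forall>h. eventually (\<lambda>N. (1 / real N) *
          (\<Sum>n=1..N. norm (f ((T ^^ (n + h)) x) - g (n + h))) < r) sequentially)"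
        using elim(1) by (intro exI[of _ "\<lambda>n. g j ((T ^^ n) x)"]) auto
    qed
  qed
qed

end
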